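(* Let $f:\mathbb{R}^n\to\mathbb{R}$ be locally Lipschitz continuous, let $\tilde f$ be a smoothing function of $f$, and let $\nabla_x\tilde f(x,\xi,\mu)$ denote stochastic gradient estimates of $\nabla_x \tilde f(x,\mu)$. Suppose that: (1) $\mathbb{E}_\xi[\nabla_x\tilde f(x,\xi,\mu)]=\nabla_x\tilde f(x,\mu)$ for all $x\in\mathbb{R}^n$, $\mu>0$; (2) there is $G>0$ with $\mathbb{E}_\xi[\|\nabla_x\tilde f(x,\xi,\mu)\|^2]\le G^2/\mu^2$ for all $x\in\mathbb{R}^n$, $\mu>0$; (3) there is $C>0$ with $|f(x)-\tilde f(x,\mu)|\le C\mu$ for all $x\in\mathbb{R}^n$, $\mu>0$; (4) there is $C_0>0$ such that for all $\mu>0$ the gradient $\nabla_x\tilde f(\cdot,\mu)$ is Lipschitz continuous on $\mathbb{R}^n$ with constant $C_0/\mu$; (5) there is $C_1>0$ such that $|\tilde f(x,\mu')-\tilde f(x,\mu)|\le C_1|\mu'-\mu|$ for all $x\in\mathbb{R}^n$ and all $\mu,\mu'>0$. Let $d\in(1,2)$ and $b\in(1/d,1)$, and let the smoothing stochastic gradient (SSG) method run with stepsizes $\alpha_k=k^{-b}$ (so that $\sum_{k=1}^\infty\alpha_k=\infty$ and $\sum_{k=1}^\infty\alpha_k^d<\infty$) and smoothing parameters $\mu_k=\alpha_k^{-\frac d3+\frac23}$. Then $$\min_{1\le k\le T}\mathbb{E}\left[\|\nabla_x\tilde f(x_k,\mu_k)\|^2\right]=\mathcal{O}\bigl(T^{-(1-b)}\bigr).$$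 Moreover, the best convergence rate of this bound (over the admissible choices of $d$ and $b$) can be arbitrarily close to the order of $T^{-1/2}$.
   Context: The problem considered is $\min_{x\in\mathbb{R}^n} f(x)$, with $f$ possibly non-smooth and non-convex. Smoothing function: for a locally Lipschitz continuous $f:\mathbb{R}^n\to\mathbb{R}$, a function $\tilde f:\mathbb{R}^n\times[0,+\infty)\to\mathbb{R}$ is a smoothing function of $f$ if for every $\mu>0$, $\tilde f(\cdot,\mu)$ is continuously differentiable on $\mathbb{R}^n$, and for every $x\in\mathbb{R}^n$, $\lim_{z\to x,\,\mu\downarrow 0}\tilde f(z,\mu)=f(x)$. Here $\nabla_x\tilde f(x,\mu)$ is the gradient of $\tilde f(\cdot,\mu)$ at $x$. $\xi$ is a random vector. For each $x$, each $\mu>0$ and each realization of $\xi$, $\nabla_x\tilde f(x,\xi,\mu)\in\mathbb{R}^n$ is a stochastic gradient estimate; $\mathbb{E}_\xi$ is the expectation with respect to the distribution of $\xi$. SSG method: given an initial point $x_1$, positive stepsizes $\{\alpha_k\}$ and positive smoothing parameters $\{\mu_k\}$ with $\mu_{k+1}\le\mu_k$, for $k=1,2,\dots$ generate a realization $\xi_k$ of $\xi$ and set $x_{k+1}=x_k-\alpha_k\nabla_x\tilde f(x_k,\xi_k,\mu_k)$. $\mathbb{E}$ denotes the total expectation over the randomness of the method, and $T$ is the number of iterations.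
   Formalization: The formal theorem additionally assumes that f is bounded below; without this the rate fails, e.g. for f(x) = -(1+x^2)^{1/4} with smoothing function -(1+mu^4+x^2)^{1/4} and noiseless gradients. *)

theory Defs
  imports "HOL-Probability.Probability" "HOL-Library.Landau_Symbols"
begin

text \<open>\<^const>\<open>gderiv\<close> is a relation; the gradient as a function is only meaningful at points of
  differentiability.\<close>

definition gradient :: "('a::euclidean_space \<Rightarrow> real) \<Rightarrow> 'a \<Rightarrow> 'a" where
  "gradient h x = (THE D. GDERIV h x :> D)"

lemma gradient_eqI: "GDERIV h x :> D \<Longrightarrow> gradient h x = D"
  unfolding gradient_def
proof (rule the_equality)
  fix D' assume D: "GDERIV h x :> D" and D': "GDERIV h x :> D'"
  have "(\<lambda>v. inner v D) = (\<lambda>v. inner v D')"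
    using D D' has_derivative_unique unfolding gderiv_def by blast
  then have "inner (D' - D) (D' - D) = 0"
    by (metis inner_diff_right cancel_comm_monoid_add_class.diff_cancel)
  then show "D' = D" by simp
qed

definition continuously_differentiable :: "('a::euclidean_space \<Rightarrow> real) \<Rightarrow> bool" where
  "continuously_differentiable h \<longleftrightarrow>
     (\<forall>x. h differentiable (at x)) \<and> continuous_on UNIV (gradient h)"

definition locally_lipschitz :: "('a::euclidean_space \<Rightarrow> real) \<Rightarrow> bool" where
  "locally_lipschitz f \<longleftrightarrow> (\<forall>x. \<exists>e>0. \<exists>L. L-lipschitz_on (ball x e) f)"

text \<open>A smoothing function has domain \<open>\<real>\<^sup>n \<times> [0,\<infinity>)\<close>; the values at negative \<open>\<mu>\<close> of the total
  function \<open>ft\<close> are never used.  In the limit the point \<open>z\<close> may be equal to \<open>x\<close>, whence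
  \<^const>\<open>nhds\<close> rather than a punctured filter.\<close>

definition smoothing_function ::
    "('a::euclidean_space \<Rightarrow> real) \<Rightarrow> ('a \<Rightarrow> real \<Rightarrow> real) \<Rightarrow> bool" where
  "smoothing_function f ft \<longleftrightarrow>
     (\<forall>\<mu>>0. continuously_differentiable (\<lambda>x. ft x \<mu>)) \<and>
     (\<forall>x. ((\<lambda>(z, \<mu>). ft z \<mu>) \<longlongrightarrow> f x) (nhds x \<times>\<^sub>F at_right 0))"

abbreviation grad_x :: "('a::euclidean_space \<Rightarrow> real \<Rightarrow> real) \<Rightarrow> 'a \<Rightarrow> real \<Rightarrow> 'a" where
  "grad_x ft x \<mu> \<equiv> gradient (\<lambda>y. ft y \<mu>) x"

text \<open>The random variables \<open>\<xi> 1, \<xi> 2, \<dots>\<close> are independent draws from the distribution \<open>D\<close>;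
  \<open>\<xi> 0\<close> is not used.\<close>

definition iid_draws ::
    "'w measure \<Rightarrow> 's::euclidean_space measure \<Rightarrow> (nat \<Rightarrow> 'w \<Rightarrow> 's) \<Rightarrow> bool" where
  "iid_draws M D \<xi> \<longleftrightarrow>
     prob_space M \<and>
     (\<forall>k\<ge>1. \<xi> k \<in> borel_measurable M \<and> distr M borel (\<xi> k) = D) \<and>
     prob_space.indep_vars M (\<lambda>_. borel) \<xi> {1..}"

text \<open>The iterates \<open>x\<^sub>1, x\<^sub>2, \<dots>\<close> for one sequence \<open>s\<close> of realizations.  The value at index \<open>0\<close> is
  junk.\<close>

primrec ssg ::
    "('a::real_vector \<Rightarrow> 's \<Rightarrow> real \<Rightarrow> 'a) \<Rightarrow> (nat \<Rightarrow> real) \<Rightarrow> (nat \<Rightarrow> real) \<Rightarrow> 'a \<Rightarrow>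
     (nat \<Rightarrow> 's) \<Rightarrow> nat \<Rightarrow> 'a" where
  "ssg g \<alpha> \<mu> x1 s 0 = x1"
| "ssg g \<alpha> \<mu> x1 s (Suc k) =
     (if k = 0 then x1
      else ssg g \<alpha> \<mu> x1 s k - \<alpha> k *\<^sub>R g (ssg g \<alpha> \<mu> x1 s k) (s k) (\<mu> k))"

definition admissible :: "real \<Rightarrow> real \<Rightarrow> bool" where
  "admissible d b \<longleftrightarrow> 1 < d \<and> d < 2 \<and> 1 / d < b \<and> b < 1"

definition stepsize :: "real \<Rightarrow> nat \<Rightarrow> real" where
  "stepsize b k = real k powr (- b)"

definition smoothing_param :: "real \<Rightarrow> real \<Rightarrow> nat \<Rightarrow> real" where
  "smoothing_param d b k = stepsize b k powr (- (d / 3) + 2 / 3)"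

text \<open>The sequences satisfy the requirements that the method puts on its parameters.\<close>

lemma admissible_parameters:
  assumes "admissible d b" "k \<ge> 1"
  shows "stepsize b k > 0" "smoothing_param d b k > 0"
    and "smoothing_param d b (Suc k) \<le> smoothing_param d b k"
proof -
  have "0 < 1 / d" "1 / d < b"
    using assms by (auto simp: admissible_def)
  then have "0 \<le> b" by linarith
  then have "real (Suc k) powr (- b) \<le> real k powr (- b)"
    using assms by (intro powr_mono2') auto
  moreover have "0 \<le> - (d / 3) + 2 / 3"
    using assms by (simp add: admissible_def)
  ultimately show "smoothing_param d b (Suc k) \<le> smoothing_param d b k"
    unfolding smoothing_param_def stepsize_def by (meson powr_ge_zero powr_mono2)
qed (use assms in \<open>auto simp: stepsize_def smoothing_param_def\<close>)

definition ssg_sq_grad ::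
    "('a::euclidean_space \<Rightarrow> real \<Rightarrow> real) \<Rightarrow> ('a \<Rightarrow> 's \<Rightarrow> real \<Rightarrow> 'a) \<Rightarrow> 'a \<Rightarrow>
     (nat \<Rightarrow> 'w \<Rightarrow> 's) \<Rightarrow> real \<Rightarrow> real \<Rightarrow> nat \<Rightarrow> 'w \<Rightarrow> real" where
  "ssg_sq_grad ft g x1 \<xi> d b k \<omega> =
     (norm (grad_x ft
              (ssg g (stepsize b) (smoothing_param d b) x1 (\<lambda>i. \<xi> i \<omega>) k)
              (smoothing_param d b k)))\<^sup>2"

text \<open>Only \<open>T \<ge> 1\<close> is meaningful: the minimum over the empty set at \<open>T = 0\<close> is unspecified.\<close>

definition ssg_min_sq_grad ::
    "'w measure \<Rightarrow> ('a::euclidean_space \<Rightarrow> real \<Rightarrow> real) \<Rightarrow> ('a \<Rightarrow> 's \<Rightarrow> real \<Rightarrow> 'a) \<Rightarrow> 'a \<Rightarrow>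
     (nat \<Rightarrow> 'w \<Rightarrow> 's) \<Rightarrow> real \<Rightarrow> real \<Rightarrow> nat \<Rightarrow> real" where
  "ssg_min_sq_grad M ft g x1 \<xi> d b T =
     Min ((\<lambda>k. \<integral>\<omega>. ssg_sq_grad ft g x1 \<xi> d b k \<omega> \<partial>M) ` {1..T})"

end

theory Submission
  imports Defs "HOL-Real_Asymp.Real_Asymp"
begin

text \<open>
  Since the stochastic gradient is a fresh draw independent of the current iterate, the descent
  lemma for the \<open>C\<^sub>0/\<mu>\<^sub>k\<close>-smooth function \<open>ft(\<cdot>, \<mu>\<^sub>k)\<close> decreases its expected value by
  \<open>\<alpha>\<^sub>k E \<parallel>\<nabla>ft(x\<^sub>k, \<mu>\<^sub>k)\<parallel>\<^sup>2\<close>, up to an error \<open>(C\<^sub>0 G\<^sup>2/2) \<alpha>\<^sub>k\<^sup>2/\<mu>\<^sub>k\<^sup>3\<close>.  The smoothing parameters are chosen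
  so that \<open>\<alpha>\<^sub>k\<^sup>2/\<mu>\<^sub>k\<^sup>3 = \<alpha>\<^sub>k\<^sup>d\<close>, which is summable, and passing from \<open>\<mu>\<^sub>k\<close> to \<open>\<mu>\<^sub>k\<^sub>+\<^sub>1\<close> costs
  \<open>C\<^sub>1 (\<mu>\<^sub>k - \<mu>\<^sub>k\<^sub>+\<^sub>1)\<close>, which telescopes.  Hence \<open>\<Sum>\<^sub>k \<alpha>\<^sub>k E \<parallel>\<nabla>ft(x\<^sub>k, \<mu>\<^sub>k)\<parallel>\<^sup>2\<close> is bounded,
  whereas \<open>\<alpha>\<^sub>1 + \<dots> + \<alpha>\<^sub>T \<ge> T\<^sup>1\<^sup>-\<^sup>b\<close>.  The rate exponent \<open>1 - b\<close> approaches \<open>1/2\<close> as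
  \<open>d \<rightarrow> 2\<close> and \<open>b - 1/d \<rightarrow> 0\<close>.
\<close>

section \<open>Gradients and the descent lemma\<close>

lemma gderiv_gradient:
  fixes h :: "'a::euclidean_space \<Rightarrow> real"
  assumes "h differentiable (at x)"
  shows "GDERIV h x :> gradient h x"
proof -
  obtain h' where h': "(h has_derivative h') (at x)"
    using assms by (auto simp: differentiable_def)
  interpret bounded_linear h'
    using h' by (rule has_derivative_bounded_linear)
  \<comment> \<open>The Riesz representative of the derivative, assembled from its values on the
    basis.\<close>
  define D where "D = (\<Sum>i\<in>Basis. h' i *\<^sub>R i)"
  have "h' v = inner v D" for v
  proof -
    have "h' v = h' (\<Sum>i\<in>Basis. inner v i *\<^sub>R i)"
      by (simp add: euclidean_representation)
    also have "\<dots> = (\<Sum>i\<in>Basis. inner v i * h' i)"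
      by (simp add: sum scaleR)
    also have "\<dots> = inner v D"
      by (simp add: D_def inner_sum_right mult.commute)
    finally show ?thesis .
  qed
  then have "h' = (\<lambda>v. inner v D)"
    by auto
  with h' have "GDERIV h x :> D"
    by (simp add: gderiv_def)
  then show ?thesis
    using gradient_eqI by metis
qed

text \<open>The descent lemma. Along the segment, the slope of \<open>h\<close> at time
  \<open>t\<close> exceeds its initial slope by at most \<open>L * t * (norm v)^2\<close>, by
  Cauchy-Schwarz and the Lipschitz bound. Subtracting the quadratic model therefore leaves a
  nonincreasing function \<open>\<phi>\<close>, and comparing its values at 0 and 1 takes the place
  of an integration.\<close>

lemma lipschitz_gradient_upper_bound:
  fixes h :: "'a::euclidean_space \<Rightarrow> real"
  assumes diff: "\<And>x. h differentiable (at x)"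
    and lip: "L-lipschitz_on UNIV (gradient h)"
  shows "h (x + v) \<le> h x + inner (gradient h x) v + L / 2 * (norm v)\<^sup>2"
proof -
  define \<phi> where "\<phi> t = h (x + t *\<^sub>R v) - t * inner (gradient h x) v - L / 2 * t\<^sup>2 * (norm v)\<^sup>2"
    for t :: real
  have nonincr: "\<exists>y. DERIV \<phi> t :> y \<and> y \<le> 0" if "0 \<le> t" for t
  proof (intro exI conjI)
    have "((\<lambda>t. h (x + t *\<^sub>R v)) has_derivative
        (\<lambda>s. inner (s *\<^sub>R v) (gradient h (x + t *\<^sub>R v)))) (at t)"
      by (rule has_derivative_compose[where f = "\<lambda>t. x + t *\<^sub>R v"])
        (use gderiv_gradient[OF diff] in \<open>auto simp: gderiv_def intro!: derivative_eq_intros\<close>)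
    then have deriv: "DERIV (\<lambda>t. h (x + t *\<^sub>R v)) t :> inner (gradient h (x + t *\<^sub>R v)) v"
      by (simp add: has_field_derivative_def inner_commute mult_commute_abs)
    show "DERIV \<phi> t :> inner (gradient h (x + t *\<^sub>R v)) v - inner (gradient h x) v
        - L * t * (norm v)\<^sup>2"
      unfolding \<phi>_def by (rule deriv derivative_eq_intros refl)+ simp
    have "inner (gradient h (x + t *\<^sub>R v) - gradient h x) v
        \<le> norm (gradient h (x + t *\<^sub>R v) - gradient h x) * norm v"
      by (rule norm_cauchy_schwarz)
    also have "\<dots> \<le> (L * (t * norm v)) * norm v"
      using lipschitz_onD[OF lip, of "x + t *\<^sub>R v" x] that
      by (intro mult_right_mono) (auto simp: dist_norm)
    finally show "inner (gradient h (x + t *\<^sub>R v)) v - inner (gradient h x) v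
        - L * t * (norm v)\<^sup>2 \<le> 0"
      by (simp add: power2_eq_square algebra_simps)
  qed
  have "\<phi> 1 \<le> \<phi> 0"
    by (rule DERIV_nonpos_imp_nonincreasing[OF zero_le_one nonincr])
  then show ?thesis
    by (simp add: \<phi>_def)
qed

section \<open>Second moments and expectations under a product law\<close>

lemma (in prob_space) norm_expectation_squared_le:
  fixes X :: "'a \<Rightarrow> 'b::euclidean_space"
  assumes "integrable M X" "integrable M (\<lambda>\<omega>. (norm (X \<omega>))\<^sup>2)"
  shows "(norm (expectation X))\<^sup>2 \<le> expectation (\<lambda>\<omega>. (norm (X \<omega>))\<^sup>2)"
proof -
  let ?v = "expectation X"
  \<comment> \<open>The variance is nonnegative; expanding the square about the mean gives the
    claim.\<close>
  have "0 \<le> expectation (\<lambda>\<omega>. (norm (X \<omega> - ?v))\<^sup>2)"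
    by simp
  also have "(\<lambda>\<omega>. (norm (X \<omega> - ?v))\<^sup>2) = (\<lambda>\<omega>. (norm (X \<omega>))\<^sup>2 - 2 * inner (X \<omega>) ?v + (norm ?v)\<^sup>2)"
    by (auto simp: power2_norm_eq_inner inner_diff_left inner_diff_right inner_commute)
  also have "expectation \<dots> = expectation (\<lambda>\<omega>. (norm (X \<omega>))\<^sup>2) - (norm ?v)\<^sup>2"
    using assms by (simp add: prob_space power2_norm_eq_inner)
  finally show ?thesis
    by simp
qed

text \<open>Averaging over \<open>Y\<close> with \<open>X\<close> frozen: Fubini for the joint law,
  where independence enters as its product form. The bound \<open>K\<close>, uniform in
  \<open>x\<close>, makes \<open>h\<close> integrable over the product because the law of
  \<open>X\<close> is a probability measure.\<close>

lemma (in prob_space) expectation_product_law: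
  fixes h :: "'b::second_countable_topology \<times> 'c::second_countable_topology \<Rightarrow> real"
  assumes "prob_space D" and sets_D: "sets D = sets borel"
    and X [measurable]: "X \<in> borel_measurable M" and Y [measurable]: "Y \<in> borel_measurable M"
    and law: "distr M (borel \<Otimes>\<^sub>M borel) (\<lambda>\<omega>. (X \<omega>, Y \<omega>)) = distr M borel X \<Otimes>\<^sub>M D"
    and h [measurable]: "h \<in> borel_measurable (borel \<Otimes>\<^sub>M borel)"
    and int: "\<And>x. integrable D (\<lambda>s. h (x, s))"
    and bound: "\<And>x. (\<integral>s. \<bar>h (x, s)\<bar> \<partial>D) \<le> K"
  shows "integrable M (\<lambda>\<omega>. h (X \<omega>, Y \<omega>))"
    and "expectation (\<lambda>\<omega>. h (X \<omega>, Y \<omega>)) = expectation (\<lambda>\<omega>. \<integral>s. h (X \<omega>, s) \<partial>D)"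
proof -
  note [measurable_cong] = sets_D
  interpret D: prob_space D by fact
  interpret X: prob_space "distr M borel X"
    by (rule prob_space_distr) fact
  interpret P: pair_prob_space "distr M borel X" D ..
  have "integrable (distr M borel X) (\<lambda>x. \<integral>s. norm (h (x, s)) \<partial>D)"
    using bound by (intro X.integrable_const_bound[where B = K]) auto
  then have *: "integrable (distr M borel X \<Otimes>\<^sub>M D) h"
    using int by (intro P.Fubini_integrable) auto
  then show "integrable M (\<lambda>\<omega>. h (X \<omega>, Y \<omega>))"
    by (simp add: law[symmetric] integrable_distr_eq)
  have "expectation (\<lambda>\<omega>. h (X \<omega>, Y \<omega>)) = integral\<^sup>L (distr M borel X \<Otimes>\<^sub>M D) h"
    by (simp add: law[symmetric] integral_distr)
  also have "\<dots> = (\<integral>x. \<integral>s. h (x, s) \<partial>D \<partial>distr M borel X)"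
    by (rule P.integral_fst'[OF *, symmetric])
  also have "\<dots> = expectation (\<lambda>\<omega>. \<integral>s. h (X \<omega>, s) \<partial>D)"
    by (rule integral_distr) auto
  finally show "expectation (\<lambda>\<omega>. h (X \<omega>, Y \<omega>)) = expectation (\<lambda>\<omega>. \<integral>s. h (X \<omega>, s) \<partial>D)" .
qed

section \<open>The iterates as random variables and one step in expectation\<close>

lemma ssg_restrict:
  assumes "{1..<k} \<subseteq> K"
  shows "ssg g \<alpha> \<mu> x1 (restrict s K) k = ssg g \<alpha> \<mu> x1 s k"
  using assms
proof (induction k)
  case (Suc k)
  then have "{1..<k} \<subseteq> K" "k \<noteq> 0 \<Longrightarrow> k \<in> K"
    by auto
  then show ?case
    using Suc.IH by simp
qed simp

lemma measurable_ssg: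
  fixes g :: "'a::euclidean_space \<Rightarrow> 's::euclidean_space \<Rightarrow> real \<Rightarrow> 'a"
  assumes g: "\<And>k. k \<ge> 1 \<Longrightarrow> (\<lambda>(x, s). g x s (\<mu> k)) \<in> borel_measurable (borel \<Otimes>\<^sub>M borel)"
    and "{1..<k} \<subseteq> K"
  shows "(\<lambda>s. ssg g \<alpha> \<mu> x1 s k) \<in> borel_measurable (PiM K (\<lambda>_. borel))"
  using assms(2)
proof (induction k)
  case (Suc k)
  show ?case
  \<comment> \<open>Indices 0 and 1 both carry \<open>x1\<close>, so draw 0 is never read and the
    coordinates \<open>{1..<k}\<close> determine iterate \<open>k\<close>.\<close>
  proof (cases "k = 0")
    case False
    then have "k \<in> K" and sub: "{1..<k} \<subseteq> K"
      using Suc.prems by auto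
    then have [measurable]: "(\<lambda>s. s k) \<in> borel_measurable (PiM K (\<lambda>_. borel))"
      by (intro measurable_component_singleton)
    note [measurable] = Suc.IH[OF sub]
    have "(\<lambda>s. (\<lambda>(x, s). g x s (\<mu> k)) (ssg g \<alpha> \<mu> x1 s k, s k))
        \<in> borel_measurable (PiM K (\<lambda>_. borel))"
      using False by (intro measurable_compose[OF _ g] measurable_Pair) auto
    then show ?thesis
      using False by simp
  qed simp
qed simp

text \<open>Iterate \<open>k\<close> is a measurable function of the draws
  \<open>1, ..., k-1\<close>, an index block disjoint from \<open>{k}\<close>. Disjoint blocks of an
  independent family are independent, so the joint law of the iterate and the fresh draw is a
  product.\<close>

lemma ssg_draw_law:
  fixes g :: "'a::euclidean_space \<Rightarrow> 's::euclidean_space \<Rightarrow> real \<Rightarrow> 'a"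
  assumes g: "\<And>k. k \<ge> 1 \<Longrightarrow> (\<lambda>(x, s). g x s (\<mu> k)) \<in> borel_measurable (borel \<Otimes>\<^sub>M borel)"
    and iid: "iid_draws M D \<xi>" and k: "k \<ge> 1"
    and X_def: "X = (\<lambda>\<omega>. ssg g \<alpha> \<mu> x1 (\<lambda>i. \<xi> i \<omega>) k)"
  shows "X \<in> borel_measurable M"
    and "distr M (borel \<Otimes>\<^sub>M borel) (\<lambda>\<omega>. (X \<omega>, \<xi> k \<omega>)) = distr M borel X \<Otimes>\<^sub>M D"
proof -
  interpret prob_space M
    using iid by (simp add: iid_draws_def)
  define P where "P = PiM {1..<k} (\<lambda>_. borel :: 's measure)"
  define Q where "Q = PiM {k} (\<lambda>_. borel :: 's measure)"
  define A where "A \<omega> = restrict (\<lambda>i. \<xi> i \<omega>) {1..<k}" for \<omega>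
  define B where "B \<omega> = restrict (\<lambda>i. \<xi> i \<omega>) {k}" for \<omega>
  have "indep_var P A Q B"
    unfolding P_def Q_def A_def B_def
    using iid k by (intro indep_var_restrict[where I = "{1..}"]) (auto simp: iid_draws_def)
  then have A [measurable]: "A \<in> M \<rightarrow>\<^sub>M P" and B [measurable]: "B \<in> M \<rightarrow>\<^sub>M Q"
    and law: "distr M P A \<Otimes>\<^sub>M distr M Q B = distr M (P \<Otimes>\<^sub>M Q) (\<lambda>\<omega>. (A \<omega>, B \<omega>))"
    by (simp_all add: indep_var_distribution_eq)
  define F where "F s = ssg g \<alpha> \<mu> x1 s k" for s
  have F [measurable]: "F \<in> borel_measurable P"
    unfolding P_def F_def by (intro measurable_ssg g) auto
  have draw [measurable]: "(\<lambda>s. s k) \<in> borel_measurable Q"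
    unfolding Q_def by (intro measurable_component_singleton) auto
  have X: "X = (\<lambda>\<omega>. F (A \<omega>))"
    by (simp add: X_def F_def A_def ssg_restrict)
  show "X \<in> borel_measurable M"
    unfolding X by measurable
  have \<xi>: "\<xi> k = (\<lambda>\<omega>. B \<omega> k)" and D: "D = distr M borel (\<xi> k)"
    using iid k by (auto simp: iid_draws_def B_def)
  \<comment> \<open>The product law of the two blocks is pushed forward by \<open>F\<close> on the
    first and by evaluation at \<open>k\<close> on the second.\<close>
  have "distr M borel X \<Otimes>\<^sub>M D
      = distr (distr M P A) borel F \<Otimes>\<^sub>M distr (distr M Q B) borel (\<lambda>s. s k)"
    unfolding D \<xi> X by (simp add: distr_distr comp_def)
  also have "\<dots> = distr (distr M P A \<Otimes>\<^sub>M distr M Q B) (borel \<Otimes>\<^sub>M borel) (\<lambda>(s, t). (F s, t k))"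
    by (intro pair_measure_distr prob_space_imp_sigma_finite prob_space.prob_space_distr
        prob_space_distr) auto
  also have "\<dots> = distr M (borel \<Otimes>\<^sub>M borel) (\<lambda>\<omega>. (X \<omega>, \<xi> k \<omega>))"
    unfolding law \<xi> X by (subst distr_distr) (auto simp: comp_def)
  finally show "distr M (borel \<Otimes>\<^sub>M borel) (\<lambda>\<omega>. (X \<omega>, \<xi> k \<omega>)) = distr M borel X \<Otimes>\<^sub>M D" ..
qed

text \<open>The descent lemma with displacement
  \<open>- a *\<^sub>R \<gamma> (X \<omega>) (Y \<omega>)\<close>, integrated. Averaging over the
  fresh draw turns the inner product into the squared gradient norm, by unbiasedness, and bounds the
  quadratic term through \<open>V\<close>. The lower bound \<open>B\<close> serves the integrability
  of the new value.\<close>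

lemma (in prob_space) expected_descent_step:
  fixes h :: "'b::euclidean_space \<Rightarrow> real" and \<gamma> :: "'b \<Rightarrow> 'c::euclidean_space \<Rightarrow> 'b"
  assumes D: "prob_space D" "sets D = sets borel"
    and X [measurable]: "X \<in> borel_measurable M" and Y [measurable]: "Y \<in> borel_measurable M"
    and law: "distr M (borel \<Otimes>\<^sub>M borel) (\<lambda>\<omega>. (X \<omega>, Y \<omega>)) = distr M borel X \<Otimes>\<^sub>M D"
    and \<gamma>: "(\<lambda>(x, s). \<gamma> x s) \<in> borel_measurable (borel \<Otimes>\<^sub>M borel)"
    and diff: "\<And>x. h differentiable (at x)"
    and lip: "L-lipschitz_on UNIV (gradient h)"
    and unbiased: "\<And>x. integrable D (\<gamma> x)" "\<And>x. (\<integral>s. \<gamma> x s \<partial>D) = gradient h x"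
    and second: "\<And>x. integrable D (\<lambda>s. (norm (\<gamma> x s))\<^sup>2)"
      "\<And>x. (\<integral>s. (norm (\<gamma> x s))\<^sup>2 \<partial>D) \<le> V"
    and below: "\<And>x. B \<le> h x"
    and int: "integrable M (\<lambda>\<omega>. h (X \<omega>))"
  shows "integrable M (\<lambda>\<omega>. (norm (gradient h (X \<omega>)))\<^sup>2)"
    and "integrable M (\<lambda>\<omega>. h (X \<omega> - a *\<^sub>R \<gamma> (X \<omega>) (Y \<omega>)))"
    and "expectation (\<lambda>\<omega>. h (X \<omega> - a *\<^sub>R \<gamma> (X \<omega>) (Y \<omega>)))
      \<le> expectation (\<lambda>\<omega>. h (X \<omega>)) - a * expectation (\<lambda>\<omega>. (norm (gradient h (X \<omega>)))\<^sup>2)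
        + L / 2 * a\<^sup>2 * V"
proof -
  interpret D: prob_space D by fact
  have "continuous_on UNIV h"
    using diff by (meson continuous_at_imp_continuous_on differentiable_imp_continuous_within)
  then have [measurable]: "h \<in> borel_measurable borel"
    by (rule borel_measurable_continuous_onI)
  have "continuous_on UNIV (gradient h)"
    using lip by (rule lipschitz_on_continuous_on)
  then have [measurable]: "gradient h \<in> borel_measurable borel"
    by (rule borel_measurable_continuous_onI)
  have [measurable]: "(\<lambda>p. \<gamma> (fst p) (snd p)) \<in> borel_measurable (borel \<Otimes>\<^sub>M borel)"
    using \<gamma> by (simp add: case_prod_beta)
  have [measurable]: "(\<lambda>\<omega>. \<gamma> (X \<omega>) (Y \<omega>)) \<in> borel_measurable M"
    using measurable_compose[OF measurable_Pair[OF X Y] \<gamma>] by simp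
  \<comment> \<open>The gradient is the mean of the estimate, so it inherits the second-moment bound
    uniformly in \<open>x\<close>.\<close>
  have grad_le: "(norm (gradient h x))\<^sup>2 \<le> V" for x
    using D.norm_expectation_squared_le[OF unbiased(1) second(1), of x] second(2)[of x]
    by (simp add: unbiased(2))
  show int_grad: "integrable M (\<lambda>\<omega>. (norm (gradient h (X \<omega>)))\<^sup>2)"
    using grad_le by (intro integrable_const_bound[where B = V]) auto

  have "integrable M (\<lambda>\<omega>. (norm (\<gamma> (X \<omega>) (Y \<omega>)))\<^sup>2)
      \<and> expectation (\<lambda>\<omega>. (norm (\<gamma> (X \<omega>) (Y \<omega>)))\<^sup>2)
        = expectation (\<lambda>\<omega>. \<integral>s. (norm (\<gamma> (X \<omega>) s))\<^sup>2 \<partial>D)"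
    using expectation_product_law[OF D X Y law, of "\<lambda>p. (norm (\<gamma> (fst p) (snd p)))\<^sup>2" V] second
    by simp
  moreover have "expectation (\<lambda>\<omega>. \<integral>s. (norm (\<gamma> (X \<omega>) s))\<^sup>2 \<partial>D) \<le> V"
  proof -
    have "expectation (\<lambda>\<omega>. \<integral>s. (norm (\<gamma> (X \<omega>) s))\<^sup>2 \<partial>D) \<le> expectation (\<lambda>\<omega>. V)"
      using second(2) order_trans[OF zero_le_power2 grad_le]
      by (intro integral_mono') auto
    then show ?thesis
      by (simp add: prob_space)
  qed
  ultimately have int_sq: "integrable M (\<lambda>\<omega>. (norm (\<gamma> (X \<omega>) (Y \<omega>)))\<^sup>2)"
    and sq_le: "expectation (\<lambda>\<omega>. (norm (\<gamma> (X \<omega>) (Y \<omega>)))\<^sup>2) \<le> V"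
    by auto

  \<comment> \<open>This is the uniform bound that Fubini asks for: Cauchy-Schwarz and
    \<open>2 * p * q \<le> p^2 + q^2\<close>, where both squares have mean at most
    \<open>V\<close>.\<close>
  have "(\<integral>s. \<bar>inner (gradient h x) (\<gamma> x s)\<bar> \<partial>D) \<le> V" for x
  proof -
    have "\<bar>inner (gradient h x) (\<gamma> x s)\<bar> \<le> (V + (norm (\<gamma> x s))\<^sup>2) / 2" for s
      using Cauchy_Schwarz_ineq2[of "gradient h x" "\<gamma> x s"] grad_le[of x]
        sum_squares_bound[of "norm (gradient h x)" "norm (\<gamma> x s)"] by simp
    then have "(\<integral>s. \<bar>inner (gradient h x) (\<gamma> x s)\<bar> \<partial>D) \<le> (\<integral>s. (V + (norm (\<gamma> x s))\<^sup>2) / 2 \<partial>D)"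
      using unbiased(1) second(1) by (intro integral_mono) auto
    also have "\<dots> = (V + (\<integral>s. (norm (\<gamma> x s))\<^sup>2 \<partial>D)) / 2"
      using second(1) by (simp add: D.prob_space)
    also have "\<dots> \<le> V"
      using second(2)[of x] by simp
    finally show ?thesis .
  qed
  then have int_inner: "integrable M (\<lambda>\<omega>. inner (gradient h (X \<omega>)) (\<gamma> (X \<omega>) (Y \<omega>)))"
    and inner_eq: "expectation (\<lambda>\<omega>. inner (gradient h (X \<omega>)) (\<gamma> (X \<omega>) (Y \<omega>)))
      = expectation (\<lambda>\<omega>. (norm (gradient h (X \<omega>)))\<^sup>2)"
    using expectation_product_law[OF D X Y law,
        of "\<lambda>p. inner (gradient h (fst p)) (\<gamma> (fst p) (snd p))" V] unbiased
    by (simp_all add: power2_norm_eq_inner)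

  define U where "U \<omega> = h (X \<omega>) - a * inner (gradient h (X \<omega>)) (\<gamma> (X \<omega>) (Y \<omega>))
    + L / 2 * a\<^sup>2 * (norm (\<gamma> (X \<omega>) (Y \<omega>)))\<^sup>2" for \<omega>
  have le_U: "h (X \<omega> - a *\<^sub>R \<gamma> (X \<omega>) (Y \<omega>)) \<le> U \<omega>" for \<omega>
    using lipschitz_gradient_upper_bound[OF diff lip, of "X \<omega>" "- (a *\<^sub>R \<gamma> (X \<omega>) (Y \<omega>))"]
    by (simp add: U_def power_mult_distrib mult.assoc)
  have int_U: "integrable M U"
    unfolding U_def using int int_inner int_sq by auto
  \<comment> \<open>The new value is squeezed between the constant \<open>B\<close> and the
    integrable \<open>U\<close>.\<close>
  show int_next: "integrable M (\<lambda>\<omega>. h (X \<omega> - a *\<^sub>R \<gamma> (X \<omega>) (Y \<omega>)))"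
  proof (rule Bochner_Integration.integrable_bound)
    show "integrable M (\<lambda>\<omega>. \<bar>U \<omega>\<bar> + \<bar>B\<bar>)"
      using int_U by auto
    have "\<bar>h (X \<omega> - a *\<^sub>R \<gamma> (X \<omega>) (Y \<omega>))\<bar> \<le> \<bar>U \<omega>\<bar> + \<bar>B\<bar>" for \<omega>
      using le_U[of \<omega>] below[of "X \<omega> - a *\<^sub>R \<gamma> (X \<omega>) (Y \<omega>)"] by linarith
    then show "AE \<omega> in M. norm (h (X \<omega> - a *\<^sub>R \<gamma> (X \<omega>) (Y \<omega>))) \<le> norm (\<bar>U \<omega>\<bar> + \<bar>B\<bar>)"
      by auto
  qed simp
  have "expectation (\<lambda>\<omega>. h (X \<omega> - a *\<^sub>R \<gamma> (X \<omega>) (Y \<omega>))) \<le> expectation U"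
    using int_next int_U le_U by (rule integral_mono)
  also have "expectation U = expectation (\<lambda>\<omega>. h (X \<omega>))
      - a * expectation (\<lambda>\<omega>. (norm (gradient h (X \<omega>)))\<^sup>2)
      + L / 2 * a\<^sup>2 * expectation (\<lambda>\<omega>. (norm (\<gamma> (X \<omega>) (Y \<omega>)))\<^sup>2)"
    unfolding U_def using int int_inner int_sq by (simp add: inner_eq)
  also have "L / 2 * a\<^sup>2 * expectation (\<lambda>\<omega>. (norm (\<gamma> (X \<omega>) (Y \<omega>)))\<^sup>2) \<le> L / 2 * a\<^sup>2 * V"
    using sq_le lipschitz_on_nonneg[OF lip] by (intro mult_left_mono) auto
  finally show "expectation (\<lambda>\<omega>. h (X \<omega> - a *\<^sub>R \<gamma> (X \<omega>) (Y \<omega>)))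
      \<le> expectation (\<lambda>\<omega>. h (X \<omega>)) - a * expectation (\<lambda>\<omega>. (norm (gradient h (X \<omega>)))\<^sup>2)
        + L / 2 * a\<^sup>2 * V"
    by simp
qed

section \<open>Stepsize sums and the choice of exponents\<close>

lemma sum_stepsize_ge:
  assumes "0 \<le> b" "T \<ge> 1"
  shows "real T powr (1 - b) \<le> (\<Sum>k=1..T. stepsize b k)"
proof -
  \<comment> \<open>Each of the \<open>T\<close> stepsizes is at least the last one,
    \<open>T powr (- b)\<close>.\<close>
  have "real T powr (1 - b) = (\<Sum>k=1..T. real T powr (- b))"
    using assms(2) by (simp add: powr_diff powr_minus_divide)
  also have "\<dots> \<le> (\<Sum>k=1..T. stepsize b k)"
    unfolding stepsize_def using assms(1) by (intro sum_mono powr_mono2') auto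
  finally show ?thesis .
qed

lemma filterlim_sum_stepsize:
  assumes "0 \<le> b" "b < 1"
  shows "filterlim (\<lambda>T. \<Sum>k=1..T. stepsize b k) at_top sequentially"
proof (rule filterlim_at_top_mono)
  show "filterlim (\<lambda>T. real T powr (1 - b)) at_top sequentially"
    using assms(2) by real_asymp
  show "\<forall>\<^sub>F T in sequentially. real T powr (1 - b) \<le> (\<Sum>k=1..T. stepsize b k)"
    using sum_stepsize_ge[OF assms(1)] by (auto simp: eventually_sequentially)
qed

text \<open>The minimum times the total weight is at most the weighted sum, hence at most
  \<open>B\<close>, and the total weight is at least \<open>T powr (1 - b)\<close>.\<close>

lemma Min_bigo_of_weighted_sums:
  fixes S :: "nat \<Rightarrow> real"
  assumes "0 \<le> b" and nonneg: "\<And>k. 0 \<le> S k"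
    and sums: "\<And>T. (\<Sum>k=1..T. stepsize b k * S k) \<le> B"
  shows "(\<lambda>T. Min (S ` {1..T})) \<in> O(\<lambda>T. real T powr (- (1 - b)))"
proof (rule bigoI)
  have "norm (Min (S ` {1..T})) \<le> B * norm (real T powr (- (1 - b)))" if T: "T \<ge> 1" for T
  proof -
    let ?m = "Min (S ` {1..T})"
    have m: "?m \<le> S k" if "k \<in> {1..T}" for k
      using that by (intro Min_le) auto
    have m0: "0 \<le> ?m"
      using T nonneg by (subst Min_ge_iff) auto
    have "?m * real T powr (1 - b) \<le> ?m * (\<Sum>k=1..T. stepsize b k)"
      by (intro mult_left_mono sum_stepsize_ge assms(1) T m0)
    also have "\<dots> = (\<Sum>k=1..T. stepsize b k * ?m)"
      unfolding sum_distrib_left by (intro sum.cong) simp_all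
    also have "\<dots> \<le> (\<Sum>k=1..T. stepsize b k * S k)"
      by (intro sum_mono mult_left_mono m) (auto simp: stepsize_def)
    also have "\<dots> \<le> B"
      by (rule sums)
    finally have "?m * real T powr (1 - b) \<le> B" .
    then show ?thesis
      using T m0 by (simp only: powr_minus_divide) (simp add: field_simps)
  qed
  then show "\<forall>\<^sub>F T in sequentially.
      norm (Min (S ` {1..T})) \<le> B * norm (real T powr (- (1 - b)))"
    by (auto simp: eventually_sequentially)
qed

lemma stepsize_sq_div_smoothing_param_cubed:
  assumes "k \<ge> 1"
  shows "(stepsize b k)\<^sup>2 / smoothing_param d b k ^ 3 = stepsize b k powr d"
proof -
  have pos: "stepsize b k > 0"
    using assms by (simp add: stepsize_def)
  \<comment> \<open>The smoothing exponent is one third of \<open>2 - d\<close>, so the quotient has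
    exponent \<open>2 - (2 - d) = d\<close>.\<close>
  have "smoothing_param d b k ^ 3 = stepsize b k powr (2 - d)"
    using pos by (simp add: smoothing_param_def powr_power)
  moreover have "(stepsize b k)\<^sup>2 = stepsize b k powr 2"
    using pos by simp
  ultimately show ?thesis
    by (simp flip: powr_diff)
qed

text \<open>The sequence starts at 1 and does not increase. The bound makes the approximation error
  \<open>C * \<mu>\<close> uniform in \<open>k\<close>.\<close>

lemma smoothing_param_le_1:
  assumes "admissible d b" "k \<ge> 1"
  shows "smoothing_param d b k \<le> 1"
  using assms(2)
proof (induction k rule: dec_induct)
  case base
  then show ?case by (simp add: smoothing_param_def stepsize_def)
next
  case (step k)
  then show ?case
    using admissible_parameters(3)[OF assms(1), of k] by simp
qed

lemma admissible_gt_half: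
  assumes "admissible d b"
  shows "1 / 2 < b"
proof -
  have "1 / 2 < 1 / d"
    using assms by (intro divide_strict_left_mono) (auto simp: admissible_def)
  with assms show ?thesis
    unfolding admissible_def by linarith
qed

lemma summable_stepsize_powr:
  assumes "admissible d b"
  shows "summable (\<lambda>k. stepsize b (Suc k) powr d)"
proof -
  \<comment> \<open>Admissibility says exactly that the p-series with exponent \<open>b * d\<close>
    converges.\<close>
  have "1 < b * d"
    using assms by (auto simp: admissible_def pos_divide_less_eq)
  then have "summable (\<lambda>k. real k powr (- (b * d)))"
    by (subst summable_real_powr_iff) simp
  then show ?thesis
    by (subst summable_Suc_iff) (simp add: stepsize_def powr_powr)
qed

lemma admissible_near_half:
  assumes "\<epsilon> > 0"
  obtains d b where "admissible d b" "1 / 2 - \<epsilon> < 1 - b"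
proof -
  \<comment> \<open>Just above 1/2, capped at 3/4 to stay below 1.\<close>
  define b where "b = min (1 / 2 + \<epsilon> / 2) (3 / 4)"
  have b: "0 < b" "1 / 2 < b" "b < 1" "b < 1 / 2 + \<epsilon>"
    using assms by (auto simp: b_def)
  \<comment> \<open>The midpoint of the interval from \<open>1 / b\<close> to 2, which is nonempty
    because \<open>b > 1/2\<close>.\<close>
  define d where "d = (1 / b + 2) / 2"
  have "1 < 1 / b" "1 / b < 2"
    using b by (simp_all add: field_simps)
  then have "1 < d" "d < 2" "1 / b < d"
    unfolding d_def by argo+
  moreover from this have "1 / d < b"
    using b by (simp add: pos_divide_less_eq mult.commute)
  ultimately show ?thesis
    using b by (intro that[of d b]) (auto simp: admissible_def)
qed

section \<open>The convergence rate\<close>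

theorem corollary3p1:
  fixes f :: "real ^ 'n \<Rightarrow> real"
    and ft :: "real ^ 'n \<Rightarrow> real \<Rightarrow> real"
    and g :: "real ^ 'n \<Rightarrow> real ^ 'm \<Rightarrow> real \<Rightarrow> real ^ 'n"
    and D :: "(real ^ 'm) measure"
    and M :: "'w measure"
    and \<xi> :: "nat \<Rightarrow> 'w \<Rightarrow> real ^ 'm"
    and x1 :: "real ^ 'n"
    and G C C0 C1 :: real
  assumes "locally_lipschitz f"
    and "bdd_below (range f)"
    and "smoothing_function f ft"
    and "prob_space D" and "sets D = sets borel"
    and "\<And>\<mu>. \<mu> > 0 \<Longrightarrow> (\<lambda>(x, s). g x s \<mu>) \<in> borel_measurable (borel \<Otimes>\<^sub>M borel)"
    and unbiased: "\<And>x \<mu>. \<mu> > 0 \<Longrightarrow>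
          integrable D (\<lambda>s. g x s \<mu>) \<and> (\<integral>s. g x s \<mu> \<partial>D) = grad_x ft x \<mu>"
    and "G > 0"
    and second_moment: "\<And>x \<mu>. \<mu> > 0 \<Longrightarrow>
          integrable D (\<lambda>s. (norm (g x s \<mu>))\<^sup>2) \<and> (\<integral>s. (norm (g x s \<mu>))\<^sup>2 \<partial>D) \<le> G\<^sup>2 / \<mu>\<^sup>2"
    and "C > 0"
    and approx: "\<And>x \<mu>. \<mu> > 0 \<Longrightarrow> \<bar>f x - ft x \<mu>\<bar> \<le> C * \<mu>"
    and "C0 > 0"
    and smooth: "\<And>\<mu>. \<mu> > 0 \<Longrightarrow> (C0 / \<mu>)-lipschitz_on UNIV (\<lambda>x. grad_x ft x \<mu>)"
    and "C1 > 0"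
    and param_lip: "\<And>x \<mu> \<mu>'. \<mu> > 0 \<Longrightarrow> \<mu>' > 0 \<Longrightarrow> \<bar>ft x \<mu>' - ft x \<mu>\<bar> \<le> C1 * \<bar>\<mu>' - \<mu>\<bar>"
    and "iid_draws M D \<xi>"
  shows
    "(\<forall>d b. admissible d b \<longrightarrow>
        filterlim (\<lambda>T. \<Sum>k=1..T. stepsize b k) at_top sequentially \<and>
        summable (\<lambda>k. stepsize b (Suc k) powr d) \<and>
        (\<forall>k\<ge>1. integrable M (ssg_sq_grad ft g x1 \<xi> d b k)) \<and>
        ssg_min_sq_grad M ft g x1 \<xi> d b \<in> O(\<lambda>T. real T powr (- (1 - b)))) \<and>
     (\<forall>d b. admissible d b \<longrightarrow> 1 - b < 1 / 2) \<and>
     (\<forall>\<epsilon>>0. \<exists>d b. admissible d b \<and> 1 / 2 - \<epsilon> < 1 - b \<and>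
        ssg_min_sq_grad M ft g x1 \<xi> d b \<in> O(\<lambda>T. real T powr (- (1 - b))))"
proof -
  note sets_D = \<open>prob_space D\<close> \<open>sets D = sets borel\<close>
  interpret prob_space M
    using \<open>iid_draws M D \<xi>\<close> by (simp add: iid_draws_def)
  have diff: "(\<lambda>x. ft x \<mu>) differentiable (at x)" if "\<mu> > 0" for x \<mu>
    using \<open>smoothing_function f ft\<close> that
    by (auto simp: smoothing_function_def continuously_differentiable_def)
  \<comment> \<open>The lower bound on \<open>f\<close>, a hypothesis added to the English
    statement, limits the total decrease that the telescoped descent can produce.\<close>
  obtain m where m: "m \<le> f x" for x
    using \<open>bdd_below (range f)\<close> by (auto simp: bdd_below_def)

  have rate: "(\<forall>k\<ge>1. integrable M (ssg_sq_grad ft g x1 \<xi> d b k)) \<and>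
      ssg_min_sq_grad M ft g x1 \<xi> d b \<in> O(\<lambda>T. real T powr (- (1 - b)))"
    if adm: "admissible d b" for d b
  proof -
    define \<alpha> where "\<alpha> = stepsize b"
    define \<mu> where "\<mu> = smoothing_param d b"
    define X where "X k \<omega> = ssg g \<alpha> \<mu> x1 (\<lambda>i. \<xi> i \<omega>) k" for k \<omega>
    define S where "S k = expectation (ssg_sq_grad ft g x1 \<xi> d b k)" for k
    define E where "E k = expectation (\<lambda>\<omega>. ft (X k \<omega>) (\<mu> k))" for k
    define c where "c = C0 * G\<^sup>2 / 2"
    have \<mu>_pos: "\<mu> k > 0" and \<mu>_mono: "\<mu> (Suc k) \<le> \<mu> k" and \<mu>_le_1: "\<mu> k \<le> 1" if "k \<ge> 1" for k
      using admissible_parameters[OF adm that] smoothing_param_le_1[OF adm that]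
      by (simp_all add: \<mu>_def)
    have sq_grad: "ssg_sq_grad ft g x1 \<xi> d b k = (\<lambda>\<omega>. (norm (grad_x ft (X k \<omega>) (\<mu> k)))\<^sup>2)" for k
      by (simp add: fun_eq_iff ssg_sq_grad_def X_def \<alpha>_def \<mu>_def)
    have ft_ge: "m - C \<le> ft x (\<mu> k)" if "k \<ge> 1" for x k
    proof -
      have "C * \<mu> k \<le> C"
        using \<open>C > 0\<close> \<mu>_le_1[OF that] by simp
      with m[of x] approx[OF \<mu>_pos[OF that], of x] show ?thesis
        by linarith
    qed
    have X: "X k \<in> borel_measurable M" and
      law: "distr M (borel \<Otimes>\<^sub>M borel) (\<lambda>\<omega>. (X k \<omega>, \<xi> k \<omega>)) = distr M borel (X k) \<Otimes>\<^sub>M D"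
      if "k \<ge> 1" for k
      by (rule ssg_draw_law[where g = g and \<mu> = \<mu> and \<alpha> = \<alpha> and ?x1.0 = x1,
            OF assms(6)[OF \<mu>_pos] \<open>iid_draws M D \<xi>\<close> that]; simp add: X_def [abs_def])+
    have X_Suc: "X (Suc k) \<omega> = X k \<omega> - \<alpha> k *\<^sub>R g (X k \<omega>) (\<xi> k \<omega>) (\<mu> k)" if "k \<ge> 1" for k \<omega>
      using that by (simp add: X_def)

    \<comment> \<open>One iteration: descent with \<open>\<mu> k\<close> held fixed, then the change
      of parameter to \<open>\<mu> (Suc k)\<close>. Integrability of the function value is carried
      along so that the step can be iterated.\<close>
    have step: "integrable M (ssg_sq_grad ft g x1 \<xi> d b k) \<and>
        integrable M (\<lambda>\<omega>. ft (X (Suc k) \<omega>) (\<mu> (Suc k))) \<and>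
        E (Suc k) + \<alpha> k * S k \<le> E k + c * \<alpha> k powr d + C1 * (\<mu> k - \<mu> (Suc k))"
      if k: "k \<ge> 1" and int: "integrable M (\<lambda>\<omega>. ft (X k \<omega>) (\<mu> k))" for k
    proof -
      have \<xi>: "\<xi> k \<in> borel_measurable M"
        using \<open>iid_draws M D \<xi>\<close> k by (simp add: iid_draws_def)
      note descent = expected_descent_step[OF sets_D X[OF k] \<xi> law[OF k] assms(6)[OF \<mu>_pos[OF k]]
          diff[OF \<mu>_pos[OF k]] smooth[OF \<mu>_pos[OF k]]
          unbiased[OF \<mu>_pos[OF k], THEN conjunct1] unbiased[OF \<mu>_pos[OF k], THEN conjunct2]
          second_moment[OF \<mu>_pos[OF k], THEN conjunct1]
          second_moment[OF \<mu>_pos[OF k], THEN conjunct2] ft_ge[OF k] int]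
      have int_grad: "integrable M (ssg_sq_grad ft g x1 \<xi> d b k)"
        using descent(1) by (simp add: sq_grad)
      have int': "integrable M (\<lambda>\<omega>. ft (X (Suc k) \<omega>) (\<mu> k))"
        using descent(2)[of "\<alpha> k"] by (simp add: X_Suc[OF k])
      \<comment> \<open>The error term of the descent step with \<open>L = C0 / \<mu> k\<close> and
        \<open>V = G^2 / (\<mu> k)^2\<close>; this is the origin of \<open>c\<close>.\<close>
      have "C0 / \<mu> k / 2 * (\<alpha> k)\<^sup>2 * (G\<^sup>2 / (\<mu> k)\<^sup>2) = c * ((\<alpha> k)\<^sup>2 / \<mu> k ^ 3)"
        by (simp add: c_def power3_eq_cube power2_eq_square mult_ac)
      also have "\<dots> = c * \<alpha> k powr d"
        using stepsize_sq_div_smoothing_param_cubed[OF k] by (simp add: \<alpha>_def \<mu>_def)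
      finally have le: "expectation (\<lambda>\<omega>. ft (X (Suc k) \<omega>) (\<mu> k)) \<le> E k - \<alpha> k * S k + c * \<alpha> k powr d"
        using descent(3)[of "\<alpha> k"] by (simp add: X_Suc[OF k] E_def S_def sq_grad)

      have change: "\<bar>ft x (\<mu> (Suc k)) - ft x (\<mu> k)\<bar> \<le> C1 * (\<mu> k - \<mu> (Suc k))" for x
        using param_lip[OF \<mu>_pos[OF k], of "\<mu> (Suc k)" x] \<mu>_pos[of "Suc k"] \<mu>_mono[OF k] by simp
      have "continuous_on UNIV (\<lambda>x. ft x (\<mu> (Suc k)))"
        using diff[OF \<mu>_pos[of "Suc k"]]
        by (intro continuous_at_imp_continuous_on ballI differentiable_imp_continuous_within) simp
      then have [measurable]: "(\<lambda>x. ft x (\<mu> (Suc k))) \<in> borel_measurable borel"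
        by (rule borel_measurable_continuous_onI)
      \<comment> \<open>Changing the parameter moves the value by at most a constant independent of
        \<open>\<omega>\<close>, so integrability transfers.\<close>
      have int_Suc: "integrable M (\<lambda>\<omega>. ft (X (Suc k) \<omega>) (\<mu> (Suc k)))"
      proof (rule Bochner_Integration.integrable_bound)
        show "integrable M (\<lambda>\<omega>. \<bar>ft (X (Suc k) \<omega>) (\<mu> k)\<bar> + C1 * (\<mu> k - \<mu> (Suc k)))"
          using int' by auto
        have "\<bar>ft x (\<mu> (Suc k))\<bar> \<le> \<bar>\<bar>ft x (\<mu> k)\<bar> + C1 * (\<mu> k - \<mu> (Suc k))\<bar>" for x
          using change[of x] by linarith
        then show "AE \<omega> in M. norm (ft (X (Suc k) \<omega>) (\<mu> (Suc k)))
            \<le> norm (\<bar>ft (X (Suc k) \<omega>) (\<mu> k)\<bar> + C1 * (\<mu> k - \<mu> (Suc k)))"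
          by simp
      qed (use X[of "Suc k"] in measurable)
      have "E (Suc k) \<le> expectation (\<lambda>\<omega>. ft (X (Suc k) \<omega>) (\<mu> k) + C1 * (\<mu> k - \<mu> (Suc k)))"
        unfolding E_def
      proof (rule integral_mono)
        show "ft (X (Suc k) \<omega>) (\<mu> (Suc k)) \<le> ft (X (Suc k) \<omega>) (\<mu> k) + C1 * (\<mu> k - \<mu> (Suc k))" for \<omega>
          using change[of "X (Suc k) \<omega>"] by linarith
      qed (use int_Suc int' in auto)
      also have "\<dots> = expectation (\<lambda>\<omega>. ft (X (Suc k) \<omega>) (\<mu> k)) + C1 * (\<mu> k - \<mu> (Suc k))"
        using int' by (simp add: prob_space)
      finally show ?thesis
        using le int_grad int_Suc by simp
    qed

    \<comment> \<open>The induction starts from the constant \<open>X 1 = x1\<close>.\<close>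
    have int: "integrable M (\<lambda>\<omega>. ft (X k \<omega>) (\<mu> k))" if "k \<ge> 1" for k
      using that
    proof (induction k rule: dec_induct)
      case base
      show ?case by (simp add: X_def)
    qed (use step in auto)

    \<comment> \<open>\<open>E k + C1 * \<mu> k\<close> acts as a potential: the decrease of
      \<open>\<mu>\<close> pays for the parameter changes.\<close>
    have telescope: "(\<Sum>k<T. \<alpha> (Suc k) * S (Suc k)) + E (Suc T) + C1 * \<mu> (Suc T)
        \<le> E 1 + C1 * \<mu> 1 + c * (\<Sum>k<T. \<alpha> (Suc k) powr d)" for T
    proof (induction T)
      case (Suc T)
      then show ?case
        using step[of "Suc T"] int[of "Suc T"] by (simp add: algebra_simps)
    qed simp
    \<comment> \<open>The final potential is at least \<open>m - C\<close>, and the partial error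
      sums stay below the convergent series, which makes the bound independent of
      \<open>T\<close>.\<close>
    have "(\<Sum>k=1..T. \<alpha> k * S k) \<le> E 1 + C1 * \<mu> 1 + c * (\<Sum>k. \<alpha> (Suc k) powr d) - (m - C)" for T
    proof -
      have "expectation (\<lambda>\<omega>. m - C) \<le> E (Suc T)"
        unfolding E_def using int[of "Suc T"] ft_ge[of "Suc T"] by (intro integral_mono) auto
      then have "m - C \<le> E (Suc T)"
        by (simp add: prob_space)
      moreover have "0 \<le> C1 * \<mu> (Suc T)"
        using \<open>C1 > 0\<close> \<mu>_pos[of "Suc T"] by simp
      moreover have "c * (\<Sum>k<T. \<alpha> (Suc k) powr d) \<le> c * (\<Sum>k. \<alpha> (Suc k) powr d)"
        using summable_stepsize_powr[OF adm] \<open>C0 > 0\<close>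
        by (intro mult_left_mono sum_le_suminf) (auto simp: \<alpha>_def c_def)
      moreover have "(\<Sum>k=1..T. \<alpha> k * S k) = (\<Sum>k<T. \<alpha> (Suc k) * S (Suc k))"
        by (simp add: sum.atLeast1_atMost_eq)
      ultimately show ?thesis
        using telescope[of T] by linarith
    qed
    moreover have "0 \<le> S k" for k
      by (simp add: S_def sq_grad)
    ultimately have "(\<lambda>T. Min (S ` {1..T})) \<in> O(\<lambda>T. real T powr (- (1 - b)))"
      using admissible_gt_half[OF adm] unfolding \<alpha>_def
      by (intro Min_bigo_of_weighted_sums) auto
    then have "ssg_min_sq_grad M ft g x1 \<xi> d b \<in> O(\<lambda>T. real T powr (- (1 - b)))"
      by (simp add: ssg_min_sq_grad_def [abs_def] S_def [abs_def])
    then show ?thesis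
      using step int by blast
  qed

  show ?thesis
  proof (intro conjI allI impI)
    fix d b
    assume adm: "admissible d b"
    show "filterlim (\<lambda>T. \<Sum>k=1..T. stepsize b k) at_top sequentially"
      using adm admissible_gt_half[OF adm]
      by (intro filterlim_sum_stepsize) (auto simp: admissible_def)
    show "summable (\<lambda>k. stepsize b (Suc k) powr d)"
      using adm by (rule summable_stepsize_powr)
    \<comment> \<open>This rules out that an expectation in the bound is merely the default value 0
      of a divergent integral.\<close>
    show "integrable M (ssg_sq_grad ft g x1 \<xi> d b k)" if "1 \<le> k" for k
      using rate[OF adm] that by blast
    show "ssg_min_sq_grad M ft g x1 \<xi> d b \<in> O(\<lambda>T. real T powr (- (1 - b)))"
      using rate[OF adm] by blast
    \<comment> \<open>Together with the last conjunct, 1/2 is the supremum of the rate exponents and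
      is not attained.\<close>
    show "1 - b < 1 / 2"
      using admissible_gt_half[OF adm] by simp
  next
    fix \<epsilon> :: real
    assume "\<epsilon> > 0"
    then obtain d b where "admissible d b" "1 / 2 - \<epsilon> < 1 - b"
      by (rule admissible_near_half)
    then show "\<exists>d b. admissible d b \<and> 1 / 2 - \<epsilon> < 1 - b \<and>
        ssg_min_sq_grad M ft g x1 \<xi> d b \<in> O(\<lambda>T. real T powr (- (1 - b)))"
      using rate by blast
  qed
qed

end
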